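(* Consider the discrete-time switched linear control system $x(t+1)=A_{\sigma(t)}x(t)+B_{\sigma(t)}u(t)$ with $A_1,\dots,A_M\in\mathbb{R}^{n\times n}$, $B_1,\dots,B_M\in\mathbb{R}^{n\times m}$. Let $\bar A\in\mathbb{R}^{Mn\times n}$ and $\bar B\in\mathbb{R}^{Mn\times m}$ be the matrices obtained by stacking vertically $A_1,\dots,A_M$ and $B_1,\dots,B_M$, respectively. Let $E_0=\{0\}$ and $E_{k+1}=\bar A^{-1}(E_k^M+\mathrm{Im}(\bar B))$ for $k\ge0$, and let $p\in\mathbb{N}$ be such that $E_p=E_{p+1}$ (so $E_p$ is the fixed point of the sequence). Then the system is Mode-Independent Fixed-Time Stabilizable (MIFTS) if and only if $E_p=\mathbb{R}^n$. Moreover, in this case a mode-independent feedback controller achieving MIFTS is linear and time-invariant, and is given by $u(t)=Kx(t)$ with $K=U_pQ_p^{-1}$, where $Q_p$ and $U_p$ are the matrices defined in the context.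
   Context: Notation: $\mathcal{M}=\{1,\dots,M\}$; $\mathbb{N}$ includes $0$; $\mathcal{S}$ is the set of all switching signals $\sigma:\mathbb{N}\to\mathcal{M}$. For a matrix $A$ and a set $V$, $A^{-1}V=\{y\mid Ay\in V\}$ is the preimage; $\mathrm{Im}(B)$ is the column space of $B$; $E_k^M=E_k\times\cdots\times E_k$ ($M$ times) $\subseteq\mathbb{R}^{Mn}$. Thus $x\in E_{k+1}$ iff there is a single $u\in\mathbb{R}^m$ with $A_jx+B_ju\in E_k$ for all $j\in\mathcal{M}$. The system is MIFTS if there exist a function $\varphi:\mathbb{R}^n\to\mathbb{R}^m$ and a time $T\in\mathbb{N}$ such that for all $x_0\in\mathbb{R}^n$ and all $\sigma\in\mathcal{S}$, the solution $\Phi^I_\sigma(t,x_0)$ of the closed loop $x(t+1)=A_{\sigma(t)}x(t)+B_{\sigma(t)}\varphi(x(t))$, $x(0)=x_0$, satisfies $\Phi^I_\sigma(t,x_0)=0$ for all $t\ge T$. The sequence $E_k$ is a non-decreasing sequence of subspaces which becomes constant after some index $p\le n$. Let $e_k=\dim E_k$ (so $e_0=0$). The matrix $Q_p=[q_1\ \cdots\ q_{e_p}]$ is built by successive basis extension: $q_1,\dots,q_{e_k}$ is a basis of $E_k$ for every $k=1,\dots,p$. For each $k\in\{0,\dots,p-1\}$ and each $i$ with $e_k+1\le i\le e_{k+1}$, choose $u_i\in\mathbb{R}^m$ with $A_jq_i+B_ju_i\in E_k$ for all $j\in\mathcal{M}$ (such a vector exists by definition of $E_{k+1}$). Set $U_p=[u_1\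 \cdots\ u_{e_p}]\in\mathbb{R}^{m\times e_p}$. *)

theory Defs
  imports "HOL-Analysis.Analysis"
begin

text \<open>
  The state space is \<open>real^'n\<close>, the input space is \<open>real^'m\<close>, and the set of modes is the finite
  type \<open>'l\<close>. Row \<open>(j, i)\<close> of a vertically stacked matrix is row \<open>i\<close> of block \<open>j\<close>, so a space of
  dimension \<open>M n\<close> is rendered as \<open>real^('l \<times> 'n)\<close>.
\<close>

definition stack :: "('l::finite \<Rightarrow> real^'c^'n) \<Rightarrow> real^'c^('l \<times> 'n)" where
  "stack A = (\<chi> ji. A (fst ji) $ snd ji)"

definition block :: "'l::finite \<Rightarrow> real^('l \<times> 'n) \<Rightarrow> real^'n" where
  "block j v = (\<chi> i. v $ (j, i))"

definition power_space :: "(real^'n) set \<Rightarrow> (real^('l::finite \<times> 'n)) set" where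
  "power_space V = {v. \<forall>j. block j v \<in> V}"

primrec E :: "('l::finite \<Rightarrow> real^'n^'n) \<Rightarrow> ('l \<Rightarrow> real^'m^'n) \<Rightarrow> nat \<Rightarrow> (real^'n) set" where
  "E A B 0 = {0}"
| "E A B (Suc k) =
     ((*v) (stack A)) -` {v + w |v w. v \<in> power_space (E A B k) \<and> w \<in> range ((*v) (stack B))}"

lemma block_stack_mult: "block j (stack C *v y) = C j *v y"
  by (simp add: block_def stack_def matrix_vector_mult_def vec_eq_iff)

lemma block_add: "block j (v + w) = block j v + block j w"
  by (simp add: block_def vec_eq_iff)

lemma mem_E_Suc_iff:
  "x \<in> E A B (Suc k) \<longleftrightarrow> (\<exists>u. \<forall>j. A j *v x + B j *v u \<in> E A B k)"
proof -
  have uminus: "C *v (- y) = - (C *v y)" for C :: "real^'d^'e" and y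
    using matrix_vector_mult_diff_distrib[of C 0 y] by simp
  show ?thesis
  proof
    assume "x \<in> E A B (Suc k)"
    then obtain v y where v: "v \<in> power_space (E A B k)"
      and eq: "stack A *v x = v + stack B *v y"
      by auto
    have "A j *v x + B j *v (- y) = block j v" for j
      using arg_cong[OF eq, of "block j"] by (simp add: block_stack_mult block_add uminus)
    with v have "\<forall>j. A j *v x + B j *v (- y) \<in> E A B k"
      by (simp add: power_space_def)
    then show "\<exists>u. \<forall>j. A j *v x + B j *v u \<in> E A B k" ..
  next
    assume "\<exists>u. \<forall>j. A j *v x + B j *v u \<in> E A B k"
    then obtain u where u: "\<And>j. A j *v x + B j *v u \<in> E A B k" by blast
    have "stack A *v x + stack B *v u \<in> power_space (E A B k)"
      using u by (simp add: power_space_def block_stack_mult block_add)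
    moreover have "stack A *v x = (stack A *v x + stack B *v u) + stack B *v (- u)"
      by (simp add: uminus)
    ultimately show "x \<in> E A B (Suc k)"
      by (simp only: E.simps vimage_eq mem_Collect_eq) blast
  qed
qed

primrec closed_loop ::
  "('l \<Rightarrow> real^'n^'n) \<Rightarrow> ('l \<Rightarrow> real^'m^'n) \<Rightarrow> (real^'n \<Rightarrow> real^'m) \<Rightarrow> (nat \<Rightarrow> 'l) \<Rightarrow>
    real^'n \<Rightarrow> nat \<Rightarrow> real^'n" where
  "closed_loop A B \<phi> \<sigma> x0 0 = x0"
| "closed_loop A B \<phi> \<sigma> x0 (Suc t) =
     A (\<sigma> t) *v closed_loop A B \<phi> \<sigma> x0 t + B (\<sigma> t) *v \<phi> (closed_loop A B \<phi> \<sigma> x0 t)"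

definition achieves_MIFTS ::
  "('l \<Rightarrow> real^'n^'n) \<Rightarrow> ('l \<Rightarrow> real^'m^'n) \<Rightarrow> (real^'n \<Rightarrow> real^'m) \<Rightarrow> bool" where
  "achieves_MIFTS A B \<phi> \<longleftrightarrow> (\<exists>T. \<forall>x0 \<sigma>. \<forall>t\<ge>T. closed_loop A B \<phi> \<sigma> x0 t = 0)"

definition MIFTS :: "('l \<Rightarrow> real^'n^'n) \<Rightarrow> ('l \<Rightarrow> real^'m^'n) \<Rightarrow> bool" where
  "MIFTS A B \<longleftrightarrow> (\<exists>\<phi>. achieves_MIFTS A B \<phi>)"

definition successive_basis ::
  "('l::finite \<Rightarrow> real^'n^'n) \<Rightarrow> ('l \<Rightarrow> real^'m^'n) \<Rightarrow> nat \<Rightarrow> (nat \<Rightarrow> real^'n) \<Rightarrow> bool" where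
  "successive_basis A B p q \<longleftrightarrow>
     (\<forall>k\<in>{1..p}. inj_on q {1..dim (E A B k)} \<and> independent (q ` {1..dim (E A B k)}) \<and>
        span (q ` {1..dim (E A B k)}) = E A B k)"

definition successive_inputs ::
  "('l::finite \<Rightarrow> real^'n^'n) \<Rightarrow> ('l \<Rightarrow> real^'m^'n) \<Rightarrow> nat \<Rightarrow>
    (nat \<Rightarrow> real^'n) \<Rightarrow> (nat \<Rightarrow> real^'m) \<Rightarrow> bool" where
  "successive_inputs A B p q u \<longleftrightarrow>
     (\<forall>k<p. \<forall>i\<in>{dim (E A B k) + 1..dim (E A B (Suc k))}. \<forall>j.
        A j *v q i + B j *v u i \<in> E A B k)"

text \<open>
  Since \<open>'n\<close> carries no order, an enumeration \<open>\<pi>\<close> of \<open>'n\<close> says which column is the first, the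
  second, and so on. The product of \<open>U\<close> with the inverse of \<open>Q\<close> does not depend on \<open>\<pi>\<close>, as long as
  both matrices use the same one. An enumeration by the numbers from \<open>1\<close> to \<open>dim (E A B p)\<close> exists
  only if \<open>E A B p\<close> is the whole space, which is also the only case in which \<open>Q\<close> is a square
  matrix and can be inverted.
\<close>

definition matrix_of_columns :: "('n \<Rightarrow> nat) \<Rightarrow> (nat \<Rightarrow> real^'r) \<Rightarrow> real^'n^'r" where
  "matrix_of_columns \<pi> f = (\<chi> r c. f (\<pi> c) $ r)"

definition feedback_matrices ::
  "('l::finite \<Rightarrow> real^'n^'n) \<Rightarrow> ('l \<Rightarrow> real^'m^'n) \<Rightarrow> nat \<Rightarrow>
    real^'n^'n \<Rightarrow> real^'n^'m \<Rightarrow> bool" where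
  "feedback_matrices A B p Q U \<longleftrightarrow>
     (\<exists>\<pi> q u. bij_betw \<pi> UNIV {1..dim (E A B p)} \<and>
        successive_basis A B p q \<and> successive_inputs A B p q u \<and>
        Q = matrix_of_columns \<pi> q \<and> U = matrix_of_columns \<pi> u)"

end

theory Submission
  imports Defs
begin

text \<open>
  If \<open>\<phi>\<close> brings every trajectory to 0 by time \<open>T\<close>, then at time \<open>T - s\<close> every trajectory is in
  \<open>E\<^sub>s\<close>: the feedback cannot see the mode at that time, so the single input \<open>\<phi> x\<close> works for
  all modes. Hence every initial state is in \<open>E\<^sub>T\<close>, which lies in \<open>E\<^sub>p\<close>. Conversely, if
  \<open>E\<^sub>p\<close> is the whole space, then \<open>K\<close> is the linear map with \<open>K q\<^sub>i = u\<^sub>i\<close>, so each \<open>A\<^sub>j + B\<^sub>j K\<close>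
  maps \<open>E\<^sub>k\<^sub>+\<^sub>1\<close> into \<open>E\<^sub>k\<close>, and every trajectory is 0 from time \<open>p\<close> on.
\<close>

section \<open>The increasing chain of subspaces and its fixed point\<close>

lemma subspace_E: "subspace (E A B k)"
proof (induction k)
  case 0
  show ?case by (simp add: subspace_0)
next
  case (Suc k)
  show ?case
    unfolding subspace_def
  proof (intro conjI ballI allI)
    show "0 \<in> E A B (Suc k)"
      unfolding mem_E_Suc_iff
      by (rule exI[of _ 0]) (simp add: subspace_0[OF Suc.IH])
  next
    fix x y assume "x \<in> E A B (Suc k)" "y \<in> E A B (Suc k)"
    then obtain u v where "\<And>j. A j *v x + B j *v u \<in> E A B k" "\<And>j. A j *v y + B j *v v \<in> E A B k"
      unfolding mem_E_Suc_iff by blast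
    then have "(A j *v x + B j *v u) + (A j *v y + B j *v v) \<in> E A B k" for j
      by (simp add: subspace_add[OF Suc.IH])
    then have "\<forall>j. A j *v (x + y) + B j *v (u + v) \<in> E A B k"
      by (simp add: matrix_vector_right_distrib algebra_simps)
    then show "x + y \<in> E A B (Suc k)"
      unfolding mem_E_Suc_iff by blast
  next
    fix c x assume "x \<in> E A B (Suc k)"
    then obtain u where "\<And>j. A j *v x + B j *v u \<in> E A B k"
      unfolding mem_E_Suc_iff by blast
    then have "c *\<^sub>R (A j *v x + B j *v u) \<in> E A B k" for j
      by (simp add: subspace_scale[OF Suc.IH])
    then have "\<forall>j. A j *v (c *\<^sub>R x) + B j *v (c *\<^sub>R u) \<in> E A B k"
      by (simp add: matrix_vector_mult_scaleR scaleR_right_distrib)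
    then show "c *\<^sub>R x \<in> E A B (Suc k)"
      unfolding mem_E_Suc_iff by blast
  qed
qed

lemma E_subset_Suc: "E A B k \<subseteq> E A B (Suc k)"
proof (induction k)
  case 0
  show ?case using subspace_0[OF subspace_E[of A B "Suc 0"]] by (simp del: E.simps(2))
next
  case (Suc k)
  then show ?case by (force simp: mem_E_Suc_iff simp del: E.simps)
qed

lemma E_mono: "k \<le> l \<Longrightarrow> E A B k \<subseteq> E A B l"
  by (rule lift_Suc_mono_le[of "E A B"]) (rule E_subset_Suc)

text \<open>Each member of the sequence determines the next one, so a single repetition at
  \<open>p\<close> propagates to every later index.\<close>

lemma E_fixed_point:
  assumes "E A B p = E A B (Suc p)" "p \<le> k"
  shows "E A B k = E A B p"
  using assms(2)
proof (induction k rule: dec_induct)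
  case (step k)
  have "E A B (Suc k) = E A B (Suc p)"
    by (rule set_eqI) (simp add: mem_E_Suc_iff step.IH del: E.simps)
  with assms(1) show ?case by simp
qed simp

lemma E_subset_fixed_point:
  assumes "E A B p = E A B (Suc p)"
  shows "E A B k \<subseteq> E A B p"
  using E_mono[of k p A B] E_fixed_point[OF assms, of k] by (cases "k \<le> p") auto

section \<open>Necessity: following trajectories backwards from time \<open>T\<close>\<close>

text \<open>Causality. It allows the mode at time \<open>t\<close> to be changed without disturbing
  the state at time \<open>t\<close>.\<close>

lemma closed_loop_cong:
  assumes "\<And>s. s < t \<Longrightarrow> \<sigma> s = \<tau> s"
  shows "closed_loop A B \<phi> \<sigma> x t = closed_loop A B \<phi> \<tau> x t"
  using assms by (induction t) auto

text \<open>Induction on the time left until \<open>T\<close>. The signal is kept arbitrary because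
  the induction hypothesis is applied to altered signals.\<close>

lemma closed_loop_mem_E:
  assumes zero: "\<And>\<sigma>. closed_loop A B \<phi> \<sigma> x T = 0" and "s \<le> T"
  shows "closed_loop A B \<phi> \<sigma> x (T - s) \<in> E A B s"
  using assms(2)
proof (induction s arbitrary: \<sigma>)
  case 0
  show ?case by (simp add: zero)
next
  case (Suc s)
  let ?t = "T - Suc s" and ?y = "closed_loop A B \<phi> \<sigma> x (T - Suc s)"
  have t: "T - s = Suc ?t" using Suc.prems by simp
  have "A j *v ?y + B j *v \<phi> ?y \<in> E A B s" for j
  proof -
    \<comment> \<open>Switching to mode \<open>j\<close> at time \<open>?t\<close> keeps the state
      \<open>?y\<close> and the input \<open>\<phi> ?y\<close>; the next state is then the one that
      mode \<open>j\<close> produces, and the induction hypothesis places it in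
      \<open>E A B s\<close>.\<close>
    have "closed_loop A B \<phi> (\<sigma>(?t := j)) x ?t = ?y"
      by (rule closed_loop_cong) simp
    then show ?thesis
      using Suc.IH[of "\<sigma>(?t := j)"] Suc.prems by (simp add: t del: fun_upd_apply) simp
  qed
  then show ?case unfolding mem_E_Suc_iff by blast
qed

lemma MIFTS_imp_E_UNIV:
  assumes "E A B p = E A B (Suc p)" "MIFTS A B"
  shows "E A B p = UNIV"
proof -
  obtain \<phi> T where zero: "\<And>x \<sigma>. closed_loop A B \<phi> \<sigma> x T = 0"
    using assms(2) unfolding MIFTS_def achieves_MIFTS_def by blast
  have "x \<in> E A B T" for x
    using closed_loop_mem_E[where s = T and T = T, OF zero] by simp
  then show ?thesis using E_subset_fixed_point[OF assms(1), of T] by blast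
qed

section \<open>Bases adapted to the chain, and their inputs\<close>

text \<open>The definition starts at \<open>k = 1\<close>; at \<open>k = 0\<close> the index range
  is empty and the span of the empty set is \<open>{0}\<close>.\<close>

lemma successive_basisD:
  assumes "successive_basis A B p q" "k \<le> p"
  shows "inj_on q {1..dim (E A B k)}" "independent (q ` {1..dim (E A B k)})"
    "span (q ` {1..dim (E A B k)}) = E A B k"
proof -
  have "inj_on q {1..dim (E A B k)} \<and> independent (q ` {1..dim (E A B k)}) \<and>
      span (q ` {1..dim (E A B k)}) = E A B k"
  proof (cases "k = 0")
    case False
    with assms show ?thesis unfolding successive_basis_def by simp
  qed (simp add: independent_empty)
  then show "inj_on q {1..dim (E A B k)}" "independent (q ` {1..dim (E A B k)})"
    "span (q ` {1..dim (E A B k)}) = E A B k" by blast+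
qed

text \<open>A basis of \<open>E A B p\<close> extends to one of \<open>E A B (Suc p)\<close>.
  Numbering the new vectors after the old ones leaves all earlier initial segments intact.\<close>

lemma successive_basis_exists: "\<exists>q. successive_basis A B p q"
proof (induction p)
  case 0
  show ?case by (simp add: successive_basis_def)
next
  case (Suc p)
  then obtain q where q: "successive_basis A B p q" by blast
  define d e where "d = dim (E A B p)" and "e = dim (E A B (Suc p))"
  have de: "d \<le> e" unfolding d_def e_def by (intro dim_subset E_subset_Suc)
  define S where "S = q ` {1..d}"
  have inj: "inj_on q {1..d}" and S: "independent S" "span S = E A B p"
    using successive_basisD[OF q order_refl] unfolding S_def d_def by blast+
  have "S \<subseteq> E A B (Suc p)"
    using S(2) span_superset[of S] E_subset_Suc by blast
  then obtain C where C: "S \<subseteq> C" "C \<subseteq> E A B (Suc p)" "independent C" "E A B (Suc p) \<subseteq> span C"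
    using maximal_independent_subset_extend[OF _ S(1)] by blast
  have spanC: "span C = E A B (Suc p)"
    using C(2,4) span_minimal[OF C(2) subspace_E] by blast
  have "finite C" using C(3) by (rule independent_imp_finite)
  moreover have "card C = e" using basis_card_eq_dim[OF C(2,4,3)] by (simp add: e_def)
  moreover have "card S = d" unfolding S_def using card_image[OF inj] by simp
  \<comment> \<open>There are \<open>e - d\<close> new vectors, exactly enough for the indices that
    follow \<open>d\<close>.\<close>
  ultimately have "card (C - S) = card {d+1..e}"
    using card_Diff_subset[of S C] C(1) finite_subset by fastforce
  then obtain f where f: "bij_betw f {d+1..e} (C - S)"
    using finite_same_card_bij[of "{d+1..e}" "C - S"] \<open>finite C\<close> by auto
  define r where "r i = (if i \<le> d then q i else f i)" for i
  have r1: "bij_betw r {1..d} S"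
    using inj by (subst bij_betw_cong[where g = q]) (auto simp: r_def S_def bij_betw_def)
  have r2: "bij_betw r {d+1..e} (C - S)"
    using f by (subst bij_betw_cong[where g = f]) (auto simp: r_def)
  have "bij_betw r ({1..d} \<union> {d+1..e}) (S \<union> (C - S))"
    by (rule bij_betw_combine[OF r1 r2]) blast
  moreover have "{1..d} \<union> {d+1..e} = {1..e}" using de by auto
  moreover have "S \<union> (C - S) = C" using C(1) by blast
  ultimately have r: "bij_betw r {1..e} C" by simp
  have "inj_on r {1..dim (E A B k)} \<and> independent (r ` {1..dim (E A B k)}) \<and>
      span (r ` {1..dim (E A B k)}) = E A B k" if "k \<le> Suc p" for k
  proof (cases "k = Suc p")
    case True
    then show ?thesis
      using r C(3) spanC unfolding e_def bij_betw_def by (simp del: E.simps)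
  next
    case False
    with that have k: "k \<le> p" by simp
    have "dim (E A B k) \<le> d" unfolding d_def by (intro dim_subset E_mono k)
    then have eq: "r i = q i" if "i \<in> {1..dim (E A B k)}" for i using that by (simp add: r_def)
    have "r ` {1..dim (E A B k)} = q ` {1..dim (E A B k)}" using eq by (rule image_cong[OF refl])
    moreover have "inj_on r {1..dim (E A B k)} = inj_on q {1..dim (E A B k)}"
      using eq by (rule inj_on_cong)
    ultimately show ?thesis using successive_basisD[OF q k] by simp
  qed
  then have "successive_basis A B (Suc p) r"
    unfolding successive_basis_def by simp
  then show ?case by blast
qed

text \<open>The dimensions are non-decreasing, so the blocks of indices are disjoint. Each
  \<open>i\<close> thus faces the condition of at most one \<open>k\<close>, and the inputs can be
  chosen index by index.\<close>

lemma successive_inputs_exists: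
  assumes "successive_basis A B p q"
  shows "\<exists>u. successive_inputs A B p q u"
proof -
  define P where "P i k \<longleftrightarrow> k < p \<and> i \<in> {dim (E A B k) + 1..dim (E A B (Suc k))}" for i k
  have "\<exists>v. \<forall>k. P i k \<longrightarrow> (\<forall>j. A j *v q i + B j *v v \<in> E A B k)" for i
  proof (cases "\<exists>k. P i k")
    case True
    then obtain k where k: "P i k" ..
    have unique: "l = k" if "P i l" for l
    proof (rule ccontr)
      assume "l \<noteq> k"
      then consider "Suc l \<le> k" | "Suc k \<le> l" by linarith
      then show False
      proof cases
        case 1
        from dim_subset[OF E_mono[OF this, of A B]] show False
          using k that unfolding P_def by (simp del: E.simps)
      next
        case 2
        from dim_subset[OF E_mono[OF this, of A B]] show False
          using k that unfolding P_def by (simp del: E.simps)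
      qed
    qed
    have "q i \<in> span (q ` {1..dim (E A B (Suc k))})"
      using k unfolding P_def by (intro span_base imageI) simp
    also have "\<dots> = E A B (Suc k)"
      using k unfolding P_def by (intro successive_basisD(3)[OF assms]) simp
    finally show ?thesis
      using unique unfolding mem_E_Suc_iff by blast
  qed blast
  then obtain u where "\<And>i k. P i k \<Longrightarrow> \<forall>j. A j *v q i + B j *v u i \<in> E A B k"
    by metis
  then have "successive_inputs A B p q u"
    unfolding successive_inputs_def P_def by blast
  then show ?thesis by blast
qed

lemma feedback_matrices_exist:
  fixes A :: "'l::finite \<Rightarrow> real^'n^'n" and B :: "'l \<Rightarrow> real^'m^'n"
  assumes "E A B p = UNIV"
  shows "\<exists>Q U. feedback_matrices A B p Q U"
proof -
  obtain q where q: "successive_basis A B p q" using successive_basis_exists by blast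
  obtain u where u: "successive_inputs A B p q u" using successive_inputs_exists[OF q] by blast
  \<comment> \<open>Only here is the fixed point required to be the whole space: its dimension must
    equal the number of columns.\<close>
  have "card (UNIV :: 'n set) = card {1..dim (E A B p)}" by (simp add: assms)
  then obtain \<pi> where "bij_betw \<pi> (UNIV :: 'n set) {1..dim (E A B p)}"
    using finite_same_card_bij[OF finite finite_atLeastAtMost] by blast
  with q u show ?thesis unfolding feedback_matrices_def by blast
qed

section \<open>Sufficiency: the linear feedback\<close>

lemma column_matrix_of_columns: "column c (matrix_of_columns \<pi> f) = f (\<pi> c)"
  by (simp add: column_def matrix_of_columns_def vec_eq_iff)

lemma matrix_of_columns_mult_axis: "matrix_of_columns \<pi> f *v axis c 1 = f (\<pi> c)"
  by (simp add: matrix_vector_mul_component matrix_vector_mult_basis column_matrix_of_columns)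

lemma matrix_inv_left:
  assumes "invertible Q"
  shows "matrix_inv Q ** Q = mat 1"
  using someI_ex[OF assms[unfolded invertible_def]] unfolding matrix_inv_def by blast

text \<open>The choice of \<open>u\<close> speaks only about the block of indices new at level
  \<open>k\<close>. An older index already lands in an earlier member of the chain, hence in
  \<open>E A B k\<close>.\<close>

lemma successive_inputs_mem_E:
  assumes u: "successive_inputs A B p q u" and "k < p" "1 \<le> i" "i \<le> dim (E A B (Suc k))"
  shows "A j *v q i + B j *v u i \<in> E A B k"
  using assms(2,4)
proof (induction k)
  case 0
  \<comment> \<open>Since \<open>E A B 0\<close> has dimension 0, every \<open>i\<close> from 1 on
    belongs to the first block.\<close>
  with u assms(3) show ?case
    unfolding successive_inputs_def by (auto simp del: E.simps(2) dest!: spec[of _ 0])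
next
  case (Suc k)
  show ?case
  proof (cases "i \<le> dim (E A B (Suc k))")
    case True
    with Suc E_subset_Suc show ?thesis by (meson Suc_lessD subsetD)
  next
    case False
    with u Suc.prems show ?thesis
      unfolding successive_inputs_def by (simp del: E.simps)
  qed
qed

lemma feedback_matrices_achieve_MIFTS:
  fixes A :: "'l::finite \<Rightarrow> real^'n^'n" and B :: "'l \<Rightarrow> real^'m^'n"
  assumes UNIV: "E A B p = UNIV" and "feedback_matrices A B p Q U"
  shows "invertible Q" and "achieves_MIFTS A B (\<lambda>x. (U ** matrix_inv Q) *v x)"
proof -
  obtain \<pi> q u where \<pi>: "bij_betw \<pi> UNIV {1..dim (E A B p)}"
    and q: "successive_basis A B p q" and u: "successive_inputs A B p q u"
    and Q: "Q = matrix_of_columns \<pi> q" and U: "U = matrix_of_columns \<pi> u"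
    using assms(2) unfolding feedback_matrices_def by blast
  have "columns Q = q ` range \<pi>"
    unfolding columns_def Q column_matrix_of_columns by auto
  also have "range \<pi> = {1..dim (E A B p)}" using \<pi> by (simp add: bij_betw_def)
  \<comment> \<open>Spanning columns give a right inverse, which suffices for the square matrix
    \<open>Q\<close>.\<close>
  finally have "span (columns Q) = UNIV"
    using successive_basisD(3)[OF q order_refl] UNIV by simp
  then show inv: "invertible Q"
    by (simp add: invertible_right_inverse matrix_right_invertible_span_columns span_vec_eq)

  define K where "K = U ** matrix_inv Q"
  have Kq: "K *v q i = u i" if i: "i \<in> {1..dim (E A B p)}" for i
  proof -
    obtain c where c: "i = \<pi> c" using i \<pi> unfolding bij_betw_def by blast
    \<comment> \<open>Writing \<open>q i\<close> as column \<open>c\<close> of \<open>Q\<close> lets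
      \<open>matrix_inv Q\<close> cancel, leaving column \<open>c\<close> of
      \<open>U\<close>.\<close>
    have "K *v q i = K *v (Q *v axis c 1)" by (simp add: c Q matrix_of_columns_mult_axis)
    also have "\<dots> = (U ** (matrix_inv Q ** Q)) *v axis c 1"
      by (simp add: K_def matrix_vector_mul_assoc matrix_mul_assoc)
    also have "\<dots> = u i"
      using inv by (simp add: matrix_inv_left c U matrix_of_columns_mult_axis)
    finally show ?thesis .
  qed
  have contract: "A j *v x + B j *v (K *v x) \<in> E A B k"
    if k: "k < p" and x: "x \<in> E A B (Suc k)" for j k x
  proof -
    \<comment> \<open>As the preimage of a subspace under a linear map, \<open>?V\<close> is a
      subspace, so it is enough to test the basis vectors of \<open>E A B (Suc k)\<close>.\<close>
    let ?V = "{x. (A j + B j ** K) *v x \<in> E A B k}"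
    have "q i \<in> ?V" if i: "i \<in> {1..dim (E A B (Suc k))}" for i
    proof -
      have "dim (E A B (Suc k)) \<le> dim (E A B p)"
        using k by (intro dim_subset E_mono) simp
      with i have "K *v q i = u i" by (intro Kq) simp
      then show ?thesis
        using successive_inputs_mem_E[OF u k, of i j] i
        by (simp add: matrix_vector_mult_add_rdistrib flip: matrix_vector_mul_assoc)
    qed
    moreover have "subspace ?V"
      using linear_subspace_vimage[OF matrix_vector_mul_linear subspace_E] by (simp add: vimage_def)
    ultimately have "span (q ` {1..dim (E A B (Suc k))}) \<subseteq> ?V"
      by (intro span_minimal) blast+
    with x k show ?thesis
      using successive_basisD(3)[OF q, of "Suc k"]
      by (auto simp add: matrix_vector_mult_add_rdistrib simp flip: matrix_vector_mul_assoc simp del: E.simps)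
  qed
  have reach: "closed_loop A B ((*v) K) \<sigma> x t \<in> E A B (p - t)" for \<sigma> x t
  proof (induction t)
    case 0
    show ?case by (simp add: UNIV)
  next
    case (Suc t)
    show ?case
    proof (cases "t < p")
      case True
      then have "p - t = Suc (p - Suc t)" by simp
      with Suc True show ?thesis by (simp add: contract del: E.simps)
    next
      \<comment> \<open>Subtraction is truncated: both \<open>p - t\<close> and
        \<open>p - Suc t\<close> are 0, so the state is already 0, and the linear feedback keeps it
        there.\<close>
      case False
      with Suc show ?thesis by simp
    qed
  qed
  have "closed_loop A B ((*v) K) \<sigma> x t = 0" if "t \<ge> p" for \<sigma> x t
    using reach[of \<sigma> x t] that by simp
  then show "achieves_MIFTS A B (\<lambda>x. (U ** matrix_inv Q) *v x)"
    unfolding achieves_MIFTS_def K_def[symmetric] by blast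
qed

theorem theorem2:
  fixes A :: "'l::finite \<Rightarrow> real^'n^'n"
    and B :: "'l \<Rightarrow> real^'m^'n"
    and p :: nat
  assumes "E A B p = E A B (p + 1)"
  shows "(MIFTS A B \<longleftrightarrow> E A B p = UNIV) \<and>
    (E A B p = UNIV \<longrightarrow>
      (\<exists>Q U. feedback_matrices A B p Q U) \<and>
      (\<forall>Q U. feedback_matrices A B p Q U \<longrightarrow>
        invertible Q \<and> achieves_MIFTS A B (\<lambda>x. (U ** matrix_inv Q) *v x)))"
proof -
  have "E A B p = E A B (Suc p)" using assms by (simp only: Suc_eq_plus1)
  from MIFTS_imp_E_UNIV[OF this] show ?thesis
    using feedback_matrices_exist feedback_matrices_achieve_MIFTS unfolding MIFTS_def by metis
qed

end
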